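(* Let $\lambda_1\ge\lambda_2\ge\lambda_3$ be real numbers with $1\pm\lambda_3\ge|\lambda_1\pm\lambda_2|$, let $N\ge1$ be an integer, and consider the Pauli channel with channel matrix $A=\mathrm{Diag}(\lambda_1,\lambda_2,\lambda_3)$ (all angle parameters zero). For measurement parameters $\underline{\tau}=(\tau_z,\tau_y,\tau_x)$ and input parameters $\underline{\vartheta}=(\vartheta_z,\vartheta_y,\vartheta_x)$, let $$\tilde g(\underline{\lambda},\underline{0},\underline{\tau},\underline{\vartheta},N)=\mathbf{E}\left((\tilde\lambda_1-\lambda_1)^2+(\tilde\lambda_2-\lambda_2)^2+(\tilde\lambda_3-\lambda_3)^2\right)=\mathbf{Var}(\hat a_{11})+\mathbf{Var}(\hat a_{22})+\mathbf{Var}(\hat a_{33}),$$ where $\tilde\lambda_i$ are the linearized contraction parameter estimators and $\hat a_{ij}$ are the entries of the channel matrix estimator $\hat A$, all defined in the context. Then for all admissible $\underline{\tau},\underline{\vartheta}$ $$\tilde g(\underline{\lambda},\underline{0},\underline{\tau},\underline{\vartheta},N)\ge\frac1N\left(3-(\lambda_1^2+\lambda_2^2+\lambda_3^2)\right),$$ and equality holds if $\underline{\tau}=\underline{\vartheta}=\underline{0}$.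
   Context: Rotations: $R_z(\phi)=\begin{pmatrix}\cos\phi&-\sin\phi&0\\ \sin\phi&\cos\phi&0\\0&0&1\end{pmatrix}$, $R_y(\phi)=\begin{pmatrix}\cos\phi&0&-\sin\phi\\0&1&0\\ \sin\phi&0&\cos\phi\end{pmatrix}$, $R_x(\phi)=\begin{pmatrix}1&0&0\\0&\cos\phi&-\sin\phi\\0&\sin\phi&\cos\phi\end{pmatrix}$. The condition $1\pm\lambda_3\ge|\lambda_1\pm\lambda_2|$ means $1+\lambda_3\ge|\lambda_1+\lambda_2|$ and $1-\lambda_3\ge|\lambda_1-\lambda_2|$; it implies $|\lambda_i|\le1$. Tomography settings: input matrix $\Theta=R_z(\vartheta_z)R_y(\vartheta_y)R_x(\vartheta_x)$ (its columns are the Bloch vectors of three input qubits) and measurement matrix $M=R_z(\tau_z)R_y(\tau_y)R_x(\tau_x)$ (its columns are the Bloch vectors of three von Neumann measurements), with $0\le\vartheta_z,\vartheta_y,\tau_z,\tau_y<\pi$ and $0\le\vartheta_x,\tau_x<\pi/2$. Put $X=(x_{ij})_{i,j=1}^3=M^TA\Theta$. The measured data are independent random variables $N_{ij}\sim\mathrm{Binom}\left(N,\frac{1+x_{ij}}2\right)$, $i,j\in\{1,2,3\}$. Estimators: $\hat x_{ij}=\frac2N N_{ij}-1$, $\hat X=(\hat x_{ij})$, $\hat A=(\hat a_{ij})=M\hat X\Theta^T$; one has $\mathbf{E}\hat A=A$. For $B\in\mathbf{M}_3(\mathbb{R})$ let $\hat\lambda_1(B)\ge\hat\lambda_2(B)\ge\hat\lambda_3(B)$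 be the eigenvalues of the symmetric matrix $\frac12(B+B^T)$. The linearized estimators are the first-order Taylor polynomials at $A$: $\tilde\lambda_i=\hat\lambda_i(A)+\langle\mathrm{grad}\,\hat\lambda_i(A),\hat A-A\rangle$, $i\in\{1,2,3\}$, with $\langle\cdot,\cdot\rangle$ the Hilbert--Schmidt inner product on $\mathbf{M}_3(\mathbb{R})\cong\mathbb{R}^9$. Here $\mathrm{grad}\,\hat\lambda_i(A)$ has its only nonzero component $\partial\hat\lambda_i/\partial\hat a_{ii}=1$, so that $\tilde\lambda_i=\lambda_i+(\hat a_{ii}-\lambda_i)=\hat a_{ii}$, which gives the variance expression for $\tilde g$; when some of the $\lambda_i$ coincide, $\tilde\lambda_i$ and $\tilde g$ are understood through this formula. *)

theory Defs
  imports "HOL-Probability.Probability" "HOL-Computational_Algebra.Polynomial"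
begin

definition rot_z :: "real \<Rightarrow> real^3^3" where
  "rot_z \<phi> = vector [vector [cos \<phi>, - sin \<phi>, 0],
                     vector [sin \<phi>, cos \<phi>, 0],
                     vector [0, 0, 1]]"

definition rot_y :: "real \<Rightarrow> real^3^3" where
  "rot_y \<phi> = vector [vector [cos \<phi>, 0, - sin \<phi>],
                     vector [0, 1, 0],
                     vector [sin \<phi>, 0, cos \<phi>]]"

definition rot_x :: "real \<Rightarrow> real^3^3" where
  "rot_x \<phi> = vector [vector [1, 0, 0],
                     vector [0, cos \<phi>, - sin \<phi>],
                     vector [0, sin \<phi>, cos \<phi>]]"

text \<open>Angle parameters are triples in the order $(z, y, x)$.\<close>

fun setting_matrix :: "real \<times> real \<times> real \<Rightarrow> real^3^3" where
  "setting_matrix (z, y, x) = rot_z z ** rot_y y ** rot_x x"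

fun admissible :: "real \<times> real \<times> real \<Rightarrow> bool" where
  "admissible (z, y, x) \<longleftrightarrow>
     0 \<le> z \<and> z < pi \<and> 0 \<le> y \<and> y < pi \<and> 0 \<le> x \<and> x < pi / 2"

definition pauli_matrix :: "real^3 \<Rightarrow> real^3^3" where
  "pauli_matrix L = (\<chi> i j. if i = j then L $ i else 0)"

definition data_matrix ::
  "real^3^3 \<Rightarrow> real \<times> real \<times> real \<Rightarrow> real \<times> real \<times> real \<Rightarrow> real^3^3" where
  "data_matrix A \<tau> \<theta> = transpose (setting_matrix \<tau>) ** A ** setting_matrix \<theta>"

definition measured_data ::
  "'w measure \<Rightarrow> nat \<Rightarrow> real^3^3 \<Rightarrow> (3 \<Rightarrow> 3 \<Rightarrow> 'w \<Rightarrow> nat) \<Rightarrow> bool" where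
  "measured_data P N X K \<longleftrightarrow>
     prob_space P \<and>
     prob_space.indep_vars P (\<lambda>_. count_space UNIV) (\<lambda>(i, j). K i j) UNIV \<and>
     (\<forall>i j. distr P (count_space UNIV) (K i j)
              = measure_pmf (binomial_pmf N ((1 + X $ i $ j) / 2)))"

definition X_hat :: "nat \<Rightarrow> (3 \<Rightarrow> 3 \<Rightarrow> 'w \<Rightarrow> nat) \<Rightarrow> 'w \<Rightarrow> real^3^3" where
  "X_hat N K \<omega> = (\<chi> i j. 2 / real N * real (K i j \<omega>) - 1)"

definition A_hat ::
  "real \<times> real \<times> real \<Rightarrow> real \<times> real \<times> real \<Rightarrow> nat \<Rightarrow>
   (3 \<Rightarrow> 3 \<Rightarrow> 'w \<Rightarrow> nat) \<Rightarrow> 'w \<Rightarrow> real^3^3" where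
  "A_hat \<tau> \<theta> N K \<omega> =
     setting_matrix \<tau> ** X_hat N K \<omega> ** transpose (setting_matrix \<theta>)"

text \<open>The characteristic polynomial $\det (t I - B)$, as a determinant over \<^typ>\<open>real poly\<close>.\<close>

definition charpoly :: "real^3^3 \<Rightarrow> real poly" where
  "charpoly B = det (\<chi> i j. [:- B $ i $ j, if i = j then 1 else 0:])"

text \<open>
  Eigenvalues of the symmetric part of \<open>B\<close>, with multiplicity and in decreasing order. A real
  symmetric matrix has only real eigenvalues, so the list has exactly three entries.
\<close>

definition lambda_hat :: "real^3^3 \<Rightarrow> real^3" where
  "lambda_hat B =
     vector (rev (sorted_list_of_multiset (proots (charpoly ((1 / 2) *\<^sub>R (B + transpose B))))))"

definition grad :: "('a::real_inner \<Rightarrow> real) \<Rightarrow> 'a \<Rightarrow> 'a" where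
  "grad f x = (THE D. GDERIV f x :> D)"

text \<open>
  The linearized estimators at the diagonal channel matrix with entries \<open>L\<close>, evaluated at the
  channel matrix estimate \<open>B\<close>. The inner product on \<^typ>\<open>real^3^3\<close> is the Hilbert--Schmidt one.
  If some of the \<open>L $ i\<close> coincide, the eigenvalue functions need not be differentiable, and
  the estimators are then given by the formula that holds in the nondegenerate case.
\<close>

definition lambda_tilde :: "real^3 \<Rightarrow> real^3^3 \<Rightarrow> real^3" where
  "lambda_tilde L B =
     (\<chi> i. if inj (\<lambda>k. L $ k)
          then lambda_hat (pauli_matrix L) $ i
               + grad (\<lambda>C. lambda_hat C $ i) (pauli_matrix L) \<bullet> (B - pauli_matrix L)
          else B $ i $ i)"

definition g_tilde ::
  "'w measure \<Rightarrow> (3 \<Rightarrow> 3 \<Rightarrow> 'w \<Rightarrow> nat) \<Rightarrow> real^3 \<Rightarrow>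
   real \<times> real \<times> real \<Rightarrow> real \<times> real \<times> real \<Rightarrow> nat \<Rightarrow> real" where
  "g_tilde P K L \<tau> \<theta> N =
     prob_space.expectation P
       (\<lambda>\<omega>. \<Sum>i\<in>UNIV. (lambda_tilde L (A_hat \<tau> \<theta> N K \<omega>) $ i - L $ i)\<^sup>2)"

end

(* With X = M^T A T, M and T the orthogonal setting matrices, independence gives
     N * Var(a_ii) = sum_{k,l} M_ik^2 T_il^2 (1 - x_kl^2).
   Summed over i, the weights w_kl = sum_i M_ik^2 T_il^2 have total 3 and satisfy w_kl <= 1, while
   sum_{k,l} x_kl^2 = sum_i lambda_i^2 because the Hilbert-Schmidt norm is orthogonally invariant.
   Hence sum_{k,l} w_kl x_kl^2 <= sum_i lambda_i^2, which is the bound.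

   For distinct lambda_i the eigenvalues of the symmetric part of B differ from the diagonal entries
   of B only by O(|B - A|^2), so the gradient of the i-th eigenvalue at A is the matrix unit E_ii. *)

theory Submission
  imports Defs
begin

section \<open>Eigenvalues of a symmetric matrix close to a diagonal one\<close>

text \<open>
  The cubic is the characteristic polynomial of the symmetric matrix with diagonal \<open>d, a, b\<close> and
  off-diagonal entries \<open>x, y, z\<close>. Dividing it by \<open>(t - a) * (t - b)\<close> leaves
  \<open>t - d\<close> up to an error of second order in \<open>e\<close>, so the intermediate value theorem applies.
\<close>

lemma cubic_root_near_diagonal:
  fixes g e d a b x y z :: real
  defines "\<delta> \<equiv> 16 * e\<^sup>2 / g"
  assumes g: "g > 0" and e: "0 \<le> e" "e \<le> g / 16"
    and gap: "\<bar>d - a\<bar> \<ge> g / 2" "\<bar>d - b\<bar> \<ge> g / 2"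
    and off: "\<bar>x\<bar> \<le> e" "\<bar>y\<bar> \<le> e" "\<bar>z\<bar> \<le> e"
  obtains r where "\<bar>r - d\<bar> \<le> \<delta>"
    and "(r - d) * (r - a) * (r - b) - (r - d) * z\<^sup>2 - (r - a) * y\<^sup>2 - (r - b) * x\<^sup>2
          - 2 * x * y * z = 0"
proof -
  define R where "R t = (t - d) * z\<^sup>2 / ((t - a) * (t - b)) + y\<^sup>2 / (t - b) + x\<^sup>2 / (t - a)
    + 2 * x * y * z / ((t - a) * (t - b))" for t
  define h where "h t = (t - d) - R t" for t
  have e2: "e\<^sup>2 \<le> (g/16) * e" using mult_right_mono[OF e(2) e(1)] by (simp add: power2_eq_square)
  have \<delta>0: "\<delta> \<ge> 0" using g by (simp add: \<delta>_def)
  have \<delta>e: "\<delta> \<le> e" using e2 g by (simp add: \<delta>_def field_simps)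
  have away: "\<bar>t - a\<bar> \<ge> g / 4" "\<bar>t - b\<bar> \<ge> g / 4" if "\<bar>t - d\<bar> \<le> \<delta>" for t
    using that gap e \<delta>e by linarith+
  have sq: "x\<^sup>2 \<le> e\<^sup>2" "y\<^sup>2 \<le> e\<^sup>2" "z\<^sup>2 \<le> e\<^sup>2"
    using off power_mono[of "\<bar>x\<bar>" e 2] power_mono[of "\<bar>y\<bar>" e 2] power_mono[of "\<bar>z\<bar>" e 2] by auto
  have R: "\<bar>R t\<bar> \<le> \<delta>" if t: "\<bar>t - d\<bar> \<le> \<delta>" for t
  proof -
    have prod: "\<bar>(t - a) * (t - b)\<bar> \<ge> (g/4) * (g/4)"
      unfolding abs_mult using away[OF t] g by (intro mult_mono) auto
    have 1: "\<bar>(t - d) * z\<^sup>2 / ((t - a) * (t - b))\<bar> \<le> (g/16) * e\<^sup>2 / ((g/4) * (g/4))"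
    proof -
      have "\<bar>(t - d) * z\<^sup>2\<bar> \<le> (g/16) * e\<^sup>2"
        unfolding abs_mult using g e \<delta>e t sq by (intro mult_mono) auto
      then show ?thesis unfolding abs_divide using prod g by (intro frac_le) auto
    qed
    have 2: "\<bar>y\<^sup>2 / (t - b)\<bar> \<le> e\<^sup>2 / (g/4)"
      unfolding abs_divide using away[OF t] g sq by (intro frac_le) auto
    have 3: "\<bar>x\<^sup>2 / (t - a)\<bar> \<le> e\<^sup>2 / (g/4)"
      unfolding abs_divide using away[OF t] g sq by (intro frac_le) auto
    have "\<bar>2 * x * y * z\<bar> = 2 * (\<bar>x\<bar> * \<bar>y\<bar>) * \<bar>z\<bar>" by (simp add: abs_mult)
    also have "\<dots> \<le> 2 * (e * e) * (g/16)"
      using off e by (intro mult_mono order_refl) auto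
    finally have "\<bar>2 * x * y * z\<bar> \<le> 2 * (g/16) * e\<^sup>2" by (simp add: power2_eq_square mult_ac)
    then have 4: "\<bar>2 * x * y * z / ((t - a) * (t - b))\<bar> \<le> 2 * (g/16) * e\<^sup>2 / ((g/4) * (g/4))"
      unfolding abs_divide using prod g by (intro frac_le) auto
    have sum4: "\<bar>p + q + u + v\<bar> \<le> p' + q' + u' + v'"
      if "\<bar>p\<bar> \<le> p'" "\<bar>q\<bar> \<le> q'" "\<bar>u\<bar> \<le> u'" "\<bar>v\<bar> \<le> v'"
      for p q u v p' q' u' v' :: real
      using that by linarith
    have "\<bar>R t\<bar> \<le> (g/16) * e\<^sup>2 / ((g/4) * (g/4)) + e\<^sup>2 / (g/4) + e\<^sup>2 / (g/4)
      + 2 * (g/16) * e\<^sup>2 / ((g/4) * (g/4))"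
      unfolding R_def by (rule sum4[OF 1 2 3 4])
    \<comment> \<open>In units of \<open>e\<^sup>2 / g\<close> the four bounds contribute 1, 4, 4
      and 2; the constant 16 in \<open>\<delta>\<close> leaves room for their sum.\<close>
    also have "\<dots> = 11 * (e\<^sup>2 / g)" using g by (simp add: field_simps)
    also have "\<dots> \<le> \<delta>" using g by (simp add: \<delta>_def divide_right_mono)
    finally show ?thesis .
  qed
  have nz: "t - a \<noteq> 0" "t - b \<noteq> 0" if "\<bar>t - d\<bar> \<le> \<delta>" for t
    using away[OF that] g by auto
  have cont: "continuous_on {d - \<delta>..d + \<delta>} h"
    unfolding h_def R_def by (intro continuous_intros) (use nz in \<open>force simp: abs_le_iff\<close>)+
  \<comment> \<open>At the two endpoints \<open>t - d\<close> equals minus and plus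
    \<open>\<delta>\<close>, which dominates \<open>R t\<close>, so \<open>h\<close> changes
    sign.\<close>
  have "h (d - \<delta>) \<le> 0" "h (d + \<delta>) \<ge> 0"
    using R[of "d - \<delta>"] R[of "d + \<delta>"] \<delta>0 by (auto simp: h_def abs_le_iff)
  then obtain r where r: "d - \<delta> \<le> r" "r \<le> d + \<delta>" "h r = 0"
    using IVT'[OF _ _ _ cont, of 0] \<delta>0 by auto
  then have rd: "\<bar>r - d\<bar> \<le> \<delta>" by auto
  have clear: "(p / (u * v) + q / v + q' / u + w / (u * v)) * (u * v) = p + q * u + q' * v + w"
    if "u \<noteq> 0" "v \<noteq> 0" for p q q' u v w :: real
    using that by (simp add: field_simps)
  have Rr: "R r * ((r - a) * (r - b))
      = (r - d) * z\<^sup>2 + y\<^sup>2 * (r - a) + x\<^sup>2 * (r - b) + 2 * x * y * z"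
    unfolding R_def by (rule clear[OF nz[OF rd]])
  have "(r - d) * (r - a) * (r - b) - (r - d) * z\<^sup>2 - (r - a) * y\<^sup>2 - (r - b) * x\<^sup>2
      - 2 * x * y * z = h r * ((r - a) * (r - b))"
    unfolding h_def left_diff_distrib[of "r - d" "R r"] Rr by (simp add: algebra_simps)
  with rd r(3) that show ?thesis by simp
qed

text \<open>Grouped around the product of the diagonal factors, so that a symmetric \<open>B\<close>
  yields the cubic of \<open>cubic_root_near_diagonal\<close>.\<close>

lemma poly_charpoly:
  "poly (charpoly B) t =
     (t - B$1$1) * (t - B$2$2) * (t - B$3$3) - (t - B$1$1) * (B$2$3 * B$3$2)
      - (t - B$2$2) * (B$1$3 * B$3$1) - (t - B$3$3) * (B$1$2 * B$2$1)
      - B$1$2 * B$2$3 * B$3$1 - B$1$3 * B$2$1 * B$3$2"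
  by (simp add: charpoly_def det_3 algebra_simps)

text \<open>Up to sign the coefficients are the determinant, the sum of the principal minors of
  order two, the trace and 1. The leading 1 settles both claims.\<close>

lemma degree_charpoly_le: "degree (charpoly B) \<le> 3"
  and charpoly_nonzero: "charpoly B \<noteq> 0"
proof -
  have "charpoly B = [:- det B, B$1$1 * B$2$2 - B$1$2 * B$2$1 + B$1$1 * B$3$3 - B$1$3 * B$3$1
      + B$2$2 * B$3$3 - B$2$3 * B$3$2, - (B$1$1 + B$2$2 + B$3$3), 1:]"
    by (simp add: charpoly_def det_3 algebra_simps)
  then show "degree (charpoly B) \<le> 3" "charpoly B \<noteq> 0" by auto
qed

text \<open>Each root in \<open>R\<close> has order at least 1, so \<open>mset_set R\<close> is
  contained in \<open>proots p\<close>. The latter has at most \<open>degree p\<close> elements,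
  hence no room for more.\<close>

lemma proots_eq_of_distinct_roots:
  fixes p :: "'a::idom poly"
  assumes "p \<noteq> 0" "finite R" "degree p \<le> card R" "\<And>r. r \<in> R \<Longrightarrow> poly p r = 0"
  shows "proots p = mset_set R"
proof -
  have "mset_set R \<subseteq># proots p"
  proof (rule mset_subset_eqI)
    fix r
    show "count (mset_set R) r \<le> count (proots p) r"
      using assms order_root[of p r] by (cases "r \<in> R") (auto simp: Suc_le_eq)
  qed
  moreover have "size (proots p) \<le> size (mset_set R)"
    using size_proots_le[of p] assms(3) by simp
  ultimately show ?thesis
    by (metis add_diff_cancel_left' diff_is_0_eq size_Diff_submset size_eq_0_iff_empty
      subset_mset.diff_add add_0)
qed

text \<open>Each diagonal entry of \<open>B\<close> has a root of the characteristic polynomial of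
  the symmetric part nearby. The gap \<open>g\<close> keeps the three roots distinct and in the
  order of the diagonal, so they are all the eigenvalues and are matched to the correct
  indices.\<close>

lemma lambda_hat_near_diagonal:
  assumes g: "g > 0" "L$1 - L$2 \<ge> g" "L$2 - L$3 \<ge> g"
    and B: "norm (B - pauli_matrix L) \<le> g / 16"
  shows "\<bar>lambda_hat B $ i - B $ i $ i\<bar> \<le> 16 * (norm (B - pauli_matrix L))\<^sup>2 / g"
proof -
  define e where "e = norm (B - pauli_matrix L)"
  define S where "S = (1/2) *\<^sub>R (B + transpose B)"
  define \<delta> where "\<delta> = 16 * e\<^sup>2 / g"
  have e: "0 \<le> e" "e \<le> g/16" using B by (auto simp: e_def)
  have "e\<^sup>2 \<le> (g/16) * e" using mult_right_mono[OF e(2) e(1)] by (simp add: power2_eq_square)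
  then have "\<delta> \<le> e" using g by (simp add: \<delta>_def field_simps)
  then have \<delta>e: "\<delta> \<le> g/16" using e by simp
  have ent: "\<bar>B$j$k - pauli_matrix L$j$k\<bar> \<le> e" for j k
    using Finite_Cartesian_Product.norm_nth_le[of "B - pauli_matrix L" j]
      Finite_Cartesian_Product.norm_nth_le[of "(B - pauli_matrix L)$j" k] by (simp add: e_def)
  have dia: "\<bar>B$j$j - L$j\<bar> \<le> e" for j
    using ent[of j j] by (simp add: pauli_matrix_def)
  have off: "\<bar>S$j$k\<bar> \<le> e" if "j \<noteq> k" for j k
    using ent[of j k] ent[of k j] that by (simp add: S_def pauli_matrix_def transpose_def)
  have Sd: "S$j$j = B$j$j" for j by (simp add: S_def transpose_def)
  have sym: "S$2$1 = S$1$2" "S$3$1 = S$1$3" "S$3$2 = S$2$3"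
    by (simp_all add: S_def transpose_def)
  note ne = off[of 1 2, simplified] off[of 1 3, simplified] off[of 2 3, simplified]
  note near = dia[of 1, unfolded abs_diff_le_iff] dia[of 2, unfolded abs_diff_le_iff]
    dia[of 3, unfolded abs_diff_le_iff] e g
  \<comment> \<open>Every diagonal entry moves by at most \<open>g/16\<close>, so gaps of at least
    \<open>g\<close> shrink by at most \<open>g/8\<close>.\<close>
  have gap: "\<bar>B$1$1 - B$2$2\<bar> \<ge> g/2" "\<bar>B$1$1 - B$3$3\<bar> \<ge> g/2" "\<bar>B$2$2 - B$3$3\<bar> \<ge> g/2"
    "\<bar>B$2$2 - B$1$1\<bar> \<ge> g/2" "\<bar>B$3$3 - B$1$1\<bar> \<ge> g/2" "\<bar>B$3$3 - B$2$2\<bar> \<ge> g/2"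
    using near by linarith+
  \<comment> \<open>The cubic lemma is used three times, with the indices permuted so that each
    diagonal entry in turn takes the place of \<open>d\<close>.\<close>
  obtain r1 where r1: "\<bar>r1 - B$1$1\<bar> \<le> \<delta>"
    and "(r1 - B$1$1) * (r1 - B$2$2) * (r1 - B$3$3) - (r1 - B$1$1) * (S$2$3)\<^sup>2
      - (r1 - B$2$2) * (S$1$3)\<^sup>2 - (r1 - B$3$3) * (S$1$2)\<^sup>2 - 2 * S$1$2 * S$1$3 * S$2$3 = 0"
    unfolding \<delta>_def by (rule cubic_root_near_diagonal[OF g(1) e gap(1,2) ne(1,2,3)])
  then have p1: "poly (charpoly S) r1 = 0"
    unfolding poly_charpoly Sd sym by algebra
  obtain r2 where r2: "\<bar>r2 - B$2$2\<bar> \<le> \<delta>"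
    and "(r2 - B$2$2) * (r2 - B$1$1) * (r2 - B$3$3) - (r2 - B$2$2) * (S$1$3)\<^sup>2
      - (r2 - B$1$1) * (S$2$3)\<^sup>2 - (r2 - B$3$3) * (S$1$2)\<^sup>2 - 2 * S$1$2 * S$2$3 * S$1$3 = 0"
    unfolding \<delta>_def by (rule cubic_root_near_diagonal[OF g(1) e gap(4,3) ne(1,3,2)])
  then have p2: "poly (charpoly S) r2 = 0"
    unfolding poly_charpoly Sd sym by algebra
  obtain r3 where r3: "\<bar>r3 - B$3$3\<bar> \<le> \<delta>"
    and "(r3 - B$3$3) * (r3 - B$1$1) * (r3 - B$2$2) - (r3 - B$3$3) * (S$1$2)\<^sup>2
      - (r3 - B$1$1) * (S$2$3)\<^sup>2 - (r3 - B$2$2) * (S$1$3)\<^sup>2 - 2 * S$1$3 * S$2$3 * S$1$2 = 0"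
    unfolding \<delta>_def by (rule cubic_root_near_diagonal[OF g(1) e gap(5,6) ne(2,3,1)])
  then have p3: "poly (charpoly S) r3 = 0"
    unfolding poly_charpoly Sd sym by algebra
  \<comment> \<open>Each root lies within \<open>e + \<delta>\<close>, hence within
    \<open>g/8\<close>, of its entry of \<open>L\<close>, while neighbouring entries differ by at
    least \<open>g\<close>.\<close>
  have lt: "r3 < r2" "r2 < r1"
    using r1[unfolded abs_diff_le_iff] r2[unfolded abs_diff_le_iff] r3[unfolded abs_diff_le_iff]
      near \<delta>e by linarith+
  have "proots (charpoly S) = mset_set {r3, r2, r1}"
    using lt p1 p2 p3 degree_charpoly_le[of S]
    by (intro proots_eq_of_distinct_roots) (auto simp: charpoly_nonzero)
  then have "sorted_list_of_multiset (proots (charpoly S)) = [r3, r2, r1]"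
    using lt by (simp add: sorted_list_of_mset_set)
  then have "lambda_hat B = vector [r1, r2, r3]"
    by (simp add: lambda_hat_def S_def)
  then show ?thesis
    using r1 r2 r3 exhaust_3[of i] by (auto simp: \<delta>_def e_def)
qed

lemma lambda_hat_pauli_matrix:
  assumes "L$1 > L$2" "L$2 > L$3"
  shows "lambda_hat (pauli_matrix L) = L"
proof -
  define g where "g = min (L$1 - L$2) (L$2 - L$3)"
  have "\<bar>lambda_hat (pauli_matrix L) $ i - L $ i\<bar> \<le> 0" for i
    using lambda_hat_near_diagonal[of g L "pauli_matrix L" i] assms
    by (simp add: g_def pauli_matrix_def)
  then show ?thesis by (simp add: vec_eq_iff)
qed

section \<open>Gradients of the eigenvalues and the linearized estimators\<close>

text \<open>\<open>grad\<close> is a definite description, so uniqueness is needed: two gradients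
  induce the same functional, and its value at \<open>D' - D\<close> shows that their difference has
  norm zero.\<close>

lemma grad_eqI:
  assumes "GDERIV f x :> D"
  shows "grad f x = D"
  unfolding grad_def
proof (rule the_equality[of _ D])
  fix D' assume "GDERIV f x :> D'"
  then have "(\<lambda>h. h \<bullet> D') = (\<lambda>h. h \<bullet> D)"
    using assms has_derivative_unique unfolding gderiv_def by blast
  then have "(D' - D) \<bullet> D' = (D' - D) \<bullet> D" by metis
  then have "(D' - D) \<bullet> (D' - D) = 0"
    by (simp only: inner_diff_right[of "D' - D"] cancel_comm_monoid_add_class.diff_cancel)
  then show "D' = D" by simp
qed (rule assms)

lemma grad_lambda_hat:
  assumes "L$1 > L$2" "L$2 > L$3"
  shows "grad (\<lambda>C. lambda_hat C $ i) (pauli_matrix L) = axis i (axis i 1)"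
proof (rule grad_eqI)
  define g where "g = min (L$1 - L$2) (L$2 - L$3)"
  have g: "g > 0" "L$1 - L$2 \<ge> g" "L$2 - L$3 \<ge> g" using assms by (auto simp: g_def)
  have in_ax: "H \<bullet> axis i (axis i 1) = H $ i $ i" for H :: "real^3^3"
    by (simp add: inner_axis)
  show "GDERIV (\<lambda>C. lambda_hat C $ i) (pauli_matrix L) :> axis i (axis i 1)"
    unfolding gderiv_def has_derivative_at_alt
  proof (intro conjI allI impI)
    show "bounded_linear (\<lambda>h. h \<bullet> axis i (axis i (1::real)))"
      by (rule bounded_linear_inner_left)
    fix c :: real assume c: "c > 0"
    show "\<exists>d>0. \<forall>B. norm (B - pauli_matrix L) < d \<longrightarrow>
      norm (lambda_hat B $ i - lambda_hat (pauli_matrix L) $ i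
        - (B - pauli_matrix L) \<bullet> axis i (axis i 1)) \<le> c * norm (B - pauli_matrix L)"
    proof (intro exI conjI allI impI)
      \<comment> \<open>The bound \<open>g/16\<close> makes the quadratic estimate applicable;
        \<open>c * g / 16\<close> turns its factor \<open>16 * ?e / g\<close> into at most
        \<open>c\<close>.\<close>
      show "min (g/16) (c * g / 16) > 0" using g c by simp
      fix B assume B: "norm (B - pauli_matrix L) < min (g/16) (c * g / 16)"
      let ?e = "norm (B - pauli_matrix L)"
      have "\<bar>lambda_hat B $ i - B $ i $ i\<bar> \<le> 16 * ?e\<^sup>2 / g"
        using B by (intro lambda_hat_near_diagonal g) auto
      also have "\<dots> = (16 * ?e / g) * ?e" by (simp add: power2_eq_square)
      also have "16 * ?e / g \<le> c" using B g by (simp add: divide_le_eq)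
      then have "(16 * ?e / g) * ?e \<le> c * ?e" by (rule mult_right_mono) simp
      finally show "norm (lambda_hat B $ i - lambda_hat (pauli_matrix L) $ i
        - (B - pauli_matrix L) \<bullet> axis i (axis i 1)) \<le> c * ?e"
        unfolding in_ax lambda_hat_pauli_matrix[OF assms] by (simp add: pauli_matrix_def)
    qed
  qed
qed

text \<open>Both branches of \<open>lambda_tilde\<close> agree here: injectivity makes the ordering
  strict, and then the first-order Taylor polynomial is
  \<open>L $ i + (B $ i $ i - L $ i)\<close>.\<close>

lemma lambda_tilde_eq:
  assumes "L$1 \<ge> L$2" "L$2 \<ge> L$3"
  shows "lambda_tilde L B $ i = B $ i $ i"
proof (cases "inj (\<lambda>k. L $ k)")
  case True
  then have "L$1 \<noteq> L$2" "L$2 \<noteq> L$3" by (auto dest: injD)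
  then have lt: "L$1 > L$2" "L$2 > L$3" using assms by auto
  have "pauli_matrix L $ i $ i = L $ i" by (simp add: pauli_matrix_def)
  then show ?thesis
    using True
    by (simp add: lambda_tilde_def grad_lambda_hat[OF lt] lambda_hat_pauli_matrix[OF lt]
      inner_axis inner_commute[of "axis _ _"])
qed (simp add: lambda_tilde_def)

section \<open>Binomial moments and variances of independent sums\<close>

text \<open>The binomial weights are the Bernstein polynomials evaluated at \<open>p\<close>, so
  their moment identities apply.\<close>

lemma expectation_binomial_pmf_real:
  assumes p: "p \<in> {0..1}"
  shows "measure_pmf.expectation (binomial_pmf n p) real = n * p"
proof -
  have "measure_pmf.expectation (binomial_pmf n p) real = (\<Sum>k\<le>n. real k * Bernstein n k p)"
    by (simp add: expectation_binomial_pmf'[OF p] Bernstein_def mult_ac)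
  then show ?thesis by (simp add: sum_k_Bernstein)
qed

lemma variance_binomial_pmf_real:
  assumes p: "p \<in> {0..1}"
  shows "measure_pmf.expectation (binomial_pmf n p) (\<lambda>k. (real k - n * p)\<^sup>2) = n * p * (1 - p)"
proof -
  \<comment> \<open>The square is rewritten through the factorial moments: \<open>(k - n p)\<^sup>2
    = k (k - 1) + (1 - 2 n p) k + (n p)\<^sup>2\<close>.\<close>
  have "measure_pmf.expectation (binomial_pmf n p) (\<lambda>k. (real k - n * p)\<^sup>2) =
      (\<Sum>k\<le>n. real k * (real k - 1) * Bernstein n k p + (1 - 2 * n * p) * (real k * Bernstein n k p)
         + (n * p)\<^sup>2 * Bernstein n k p)"
    unfolding expectation_binomial_pmf'[OF p]
    by (intro sum.cong) (simp_all add: Bernstein_def algebra_simps power2_eq_square)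
  also have "\<dots> = n * p * (1 - p)"
    by (simp add: sum.distrib sum_distrib_left[symmetric] sum_k_Bernstein sum_kk_Bernstein
      sum_Bernstein) (simp add: algebra_simps power2_eq_square)
  finally show ?thesis .
qed

context prob_space begin

text \<open>The square of the centred sum expands into products of centred variables, and
  independence makes the mixed products have expectation zero. Integrability is recorded too, since
  it is what later allows expectation and sum to be exchanged.\<close>

lemma variance_sum_indep:
  fixes X :: "'i \<Rightarrow> 'a \<Rightarrow> real"
  assumes "finite I" and ind: "indep_vars (\<lambda>_. borel) X I"
    and int: "\<And>i. i \<in> I \<Longrightarrow> integrable M (X i)"
    and int2: "\<And>i. i \<in> I \<Longrightarrow> integrable M (\<lambda>\<omega>. (X i \<omega> - expectation (X i))\<^sup>2)"
  shows "variance (\<lambda>\<omega>. \<Sum>i\<in>I. c i * X i \<omega>) = (\<Sum>i\<in>I. (c i)\<^sup>2 * variance (X i))"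
    and "integrable M (\<lambda>\<omega>. ((\<Sum>i\<in>I. c i * X i \<omega>) - expectation (\<lambda>\<omega>. \<Sum>i\<in>I. c i * X i \<omega>))\<^sup>2)"
proof -
  define Z where "Z = (\<lambda>i \<omega>. X i \<omega> - expectation (X i))"
  have Z: "integrable M (Z i)" "expectation (Z i) = 0" if "i \<in> I" for i
    using int[OF that] by (auto simp: Z_def prob_space)
  have indZ: "indep_vars (\<lambda>_. borel) Z I"
    unfolding Z_def by (rule indep_vars_compose2[OF ind]) auto
  have ZZ: "integrable M (\<lambda>\<omega>. Z i \<omega> * Z j \<omega>) \<and>
      expectation (\<lambda>\<omega>. Z i \<omega> * Z j \<omega>) = (if i = j then variance (X i) else 0)"
    if ij: "i \<in> I" "j \<in> I" for i j
  proof (cases "i = j")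
    case True
    then show ?thesis using int2[OF ij(1)] by (simp add: Z_def power2_eq_square)
  next
    case False
    have "indep_vars (\<lambda>_. borel) Z {i, j}" by (rule indep_vars_subset[OF indZ]) (use ij in auto)
    from indep_vars_lebesgue_integral[OF _ this] indep_vars_integrable[OF _ this] False Z ij
    show ?thesis by auto
  qed
  have sq: "((\<Sum>i\<in>I. c i * X i \<omega>) - expectation (\<lambda>\<omega>. \<Sum>i\<in>I. c i * X i \<omega>))\<^sup>2
      = (\<Sum>i\<in>I. \<Sum>j\<in>I. (c i * c j) * (Z i \<omega> * Z j \<omega>))" for \<omega>
  proof -
    have "(\<Sum>i\<in>I. c i * X i \<omega>) - expectation (\<lambda>\<omega>. \<Sum>i\<in>I. c i * X i \<omega>) = (\<Sum>i\<in>I. c i * Z i \<omega>)"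
      using int by (simp add: Z_def right_diff_distrib sum_subtractf)
    then show ?thesis by (simp add: power2_eq_square sum_product mult_ac)
  qed
  show "integrable M (\<lambda>\<omega>. ((\<Sum>i\<in>I. c i * X i \<omega>) - expectation (\<lambda>\<omega>. \<Sum>i\<in>I. c i * X i \<omega>))\<^sup>2)"
    unfolding sq using ZZ by simp
  have "variance (\<lambda>\<omega>. \<Sum>i\<in>I. c i * X i \<omega>)
      = (\<Sum>i\<in>I. \<Sum>j\<in>I. (c i * c j) * expectation (\<lambda>\<omega>. Z i \<omega> * Z j \<omega>))"
    unfolding sq using ZZ by simp
  also have "\<dots> = (\<Sum>i\<in>I. \<Sum>j\<in>I. if i = j then (c i)\<^sup>2 * variance (X i) else 0)"
    using ZZ by (intro sum.cong) (auto simp: power2_eq_square)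
  finally show "variance (\<lambda>\<omega>. \<Sum>i\<in>I. c i * X i \<omega>) = (\<Sum>i\<in>I. (c i)\<^sup>2 * variance (X i))"
    using \<open>finite I\<close> by simp
qed

end

section \<open>Orthogonality of the settings and the Hilbert-Schmidt norm\<close>

lemma orthogonal_setting_matrix: "orthogonal_matrix (setting_matrix \<tau>)"
proof -
  note entries = orthogonal_matrix vec_eq_iff forall_3 matrix_matrix_mult_def sum_3 transpose_def
    mat_def power2_eq_square[symmetric]
  have "orthogonal_matrix (rot_z a)" "orthogonal_matrix (rot_y a)" "orthogonal_matrix (rot_x a)" for a
    by (simp_all add: entries rot_z_def rot_y_def rot_x_def)
  then show ?thesis
    by (cases \<tau>) (simp add: orthogonal_matrix_mul)
qed

lemma setting_matrix_zero: "setting_matrix (0, 0, 0) = mat 1"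
  by (simp add: rot_z_def rot_y_def rot_x_def vec_eq_iff forall_3 matrix_matrix_mult_def sum_3 mat_def)

lemma orthogonal_matrix_row_sum_squares:
  fixes Q :: "real^'n^'n"
  assumes "orthogonal_matrix Q"
  shows "(\<Sum>k\<in>UNIV. (Q$i$k)\<^sup>2) = 1"
proof -
  have "(Q ** transpose Q)$i$i = 1" using assms by (simp add: orthogonal_matrix_def mat_def)
  then show ?thesis by (simp add: matrix_matrix_mult_def transpose_def power2_eq_square)
qed

lemma orthogonal_matrix_column_sum_squares:
  fixes Q :: "real^'n^'n"
  assumes "orthogonal_matrix Q"
  shows "(\<Sum>k\<in>UNIV. (Q$k$i)\<^sup>2) = 1"
proof -
  have "(\<Sum>k\<in>UNIV. (transpose Q$i$k)\<^sup>2) = 1"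
    by (rule orthogonal_matrix_row_sum_squares) (simp add: assms)
  then show ?thesis by (simp add: transpose_def)
qed

text \<open>The columns of \<open>Q ** B\<close> are the images under \<open>Q\<close> of the
  columns of \<open>B\<close>, and \<open>Q\<close> preserves their Euclidean norms.\<close>

lemma sum_squares_orthogonal_mult_left:
  fixes Q B :: "real^'n^'n"
  assumes "orthogonal_matrix Q"
  shows "(\<Sum>k\<in>UNIV. \<Sum>l\<in>UNIV. ((Q ** B)$k$l)\<^sup>2) = (\<Sum>k\<in>UNIV. \<Sum>l\<in>UNIV. (B$k$l)\<^sup>2)"
proof -
  have "(\<Sum>k\<in>UNIV. ((Q ** B)$k$l)\<^sup>2) = (\<Sum>k\<in>UNIV. (B$k$l)\<^sup>2)" for l
  proof -
    have "norm (Q *v column l B) = norm (column l B)"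
      using assms orthogonal_transformation_matrix[of "(*v) Q"]
      by (simp add: orthogonal_transformation_norm)
    then have "(Q *v column l B) \<bullet> (Q *v column l B) = column l B \<bullet> column l B"
      by (simp add: norm_eq)
    then show ?thesis
      by (simp add: inner_vec_def matrix_vector_mult_def column_def matrix_matrix_mult_def
        power2_eq_square)
  qed
  then show ?thesis
    by (subst sum.swap, subst (2) sum.swap) simp
qed

lemma sum_squares_orthogonal_mult_right:
  fixes Q B :: "real^'n^'n"
  assumes "orthogonal_matrix Q"
  shows "(\<Sum>k\<in>UNIV. \<Sum>l\<in>UNIV. ((B ** Q)$k$l)\<^sup>2) = (\<Sum>k\<in>UNIV. \<Sum>l\<in>UNIV. (B$k$l)\<^sup>2)"
proof -
  have tr: "(\<Sum>k\<in>UNIV. \<Sum>l\<in>UNIV. (transpose C$k$l)\<^sup>2) = (\<Sum>k\<in>UNIV. \<Sum>l\<in>UNIV. (C$k$l)\<^sup>2)"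
    for C :: "real^'n^'n"
    by (subst sum.swap) (simp add: transpose_def)
  have "(\<Sum>k\<in>UNIV. \<Sum>l\<in>UNIV. ((transpose Q ** transpose B)$k$l)\<^sup>2)
      = (\<Sum>k\<in>UNIV. \<Sum>l\<in>UNIV. (transpose B$k$l)\<^sup>2)"
    by (rule sum_squares_orthogonal_mult_left) (simp add: assms)
  then show ?thesis
    by (simp add: tr flip: matrix_transpose_mul)
qed

lemma sum_squares_data_matrix:
  "(\<Sum>k\<in>UNIV. \<Sum>l\<in>UNIV. (data_matrix A \<tau> \<theta> $k$l)\<^sup>2) = (\<Sum>k\<in>UNIV. \<Sum>l\<in>UNIV. (A$k$l)\<^sup>2)"
  by (simp add: data_matrix_def sum_squares_orthogonal_mult_left sum_squares_orthogonal_mult_right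
    orthogonal_setting_matrix)

text \<open>This is what makes the channel matrix estimator unbiased: applying it to the exact data
  returns \<open>A\<close>.\<close>

lemma setting_matrix_data_matrix:
  "setting_matrix \<tau> ** data_matrix A \<tau> \<theta> ** transpose (setting_matrix \<theta>) = A"
proof -
  let ?M = "setting_matrix \<tau>" and ?T = "setting_matrix \<theta>"
  have "?M ** data_matrix A \<tau> \<theta> ** transpose ?T = (?M ** transpose ?M) ** A ** (?T ** transpose ?T)"
    by (simp add: data_matrix_def matrix_mul_assoc)
  also have "\<dots> = A"
    using orthogonal_setting_matrix[of \<tau>] orthogonal_setting_matrix[of \<theta>]
    by (simp add: orthogonal_matrix_def)
  finally show ?thesis .
qed

text \<open>Ensures that \<open>(1 + x) / 2\<close> is a probability for each entry \<open>x\<close>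
  of the data matrix. An entry is a sum of \<open>L$i\<close> times products from two unit columns,
  each product being bounded by the mean of the two squares.\<close>

lemma abs_data_matrix_pauli_le_1:
  assumes "\<And>i. \<bar>L$i\<bar> \<le> 1"
  shows "\<bar>data_matrix (pauli_matrix L) \<tau> \<theta> $k$l\<bar> \<le> 1"
proof -
  let ?M = "setting_matrix \<tau>" and ?T = "setting_matrix \<theta>"
  have "data_matrix (pauli_matrix L) \<tau> \<theta> $k$l = (\<Sum>i\<in>UNIV. L$i * (?M$i$k * ?T$i$l))"
    by (simp add: data_matrix_def pauli_matrix_def matrix_matrix_mult_def transpose_def
      if_distrib[of "\<lambda>x. _ * x"] mult_ac cong: if_cong)
  also have "\<bar>\<dots>\<bar> \<le> (\<Sum>i\<in>UNIV. \<bar>L$i * (?M$i$k * ?T$i$l)\<bar>)" by (rule sum_abs)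
  also have "\<dots> \<le> (\<Sum>i\<in>UNIV. ((?M$i$k)\<^sup>2 + (?T$i$l)\<^sup>2) / 2)"
  proof (rule sum_mono)
    fix i
    have "\<bar>L$i * (?M$i$k * ?T$i$l)\<bar> \<le> 1 * (\<bar>?M$i$k\<bar> * \<bar>?T$i$l\<bar>)"
      unfolding abs_mult using assms[of i] by (intro mult_right_mono) auto
    also have "\<dots> \<le> ((?M$i$k)\<^sup>2 + (?T$i$l)\<^sup>2) / 2"
      using sum_squares_bound[of "\<bar>?M$i$k\<bar>" "\<bar>?T$i$l\<bar>"] by simp
    finally show "\<bar>L$i * (?M$i$k * ?T$i$l)\<bar> \<le> ((?M$i$k)\<^sup>2 + (?T$i$l)\<^sup>2) / 2" .
  qed
  also have "\<dots> = 1"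
    by (simp add: sum.distrib orthogonal_matrix_column_sum_squares orthogonal_setting_matrix
      flip: sum_divide_distrib)
  finally show ?thesis .
qed

section \<open>Means and variances of the estimators\<close>

text \<open>The estimator is an affine function of a binomial variable with success probability
  \<open>p = (1 + X$k$l) / 2\<close>, so its variance is \<open>4 p (1 - p) / N\<close>.
  Integrability holds for every \<open>f\<close> because a binomial law has finite support.\<close>

lemma
  assumes md: "measured_data P N X K" and N: "N \<ge> 1" and X: "\<bar>X$k$l\<bar> \<le> 1"
  shows integrable_measured_data: "integrable P (\<lambda>\<omega>. f (K k l \<omega>) :: real)"
    and expectation_X_hat: "prob_space.expectation P (\<lambda>\<omega>. X_hat N K \<omega> $k$l) = X$k$l"
    and variance_X_hat:
      "prob_space.variance P (\<lambda>\<omega>. X_hat N K \<omega> $k$l) = (1 - (X$k$l)\<^sup>2) / real N"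
proof -
  interpret prob_space P using md by (simp add: measured_data_def)
  define p where "p = (1 + X$k$l) / 2"
  have p: "p \<in> {0..1}" using X by (auto simp: p_def)
  have "indep_vars (\<lambda>_. count_space UNIV) (\<lambda>(i, j). K i j) UNIV"
    using md by (simp add: measured_data_def)
  then have meas: "K k l \<in> measurable P (count_space UNIV)"
    unfolding indep_vars_def by (auto dest: bspec[of _ _ "(k, l)"])
  have distr: "distr P (count_space UNIV) (K k l) = measure_pmf (binomial_pmf N p)"
    using md by (simp add: measured_data_def p_def)
  have int: "integrable P (\<lambda>\<omega>. h (K k l \<omega>))" for h :: "nat \<Rightarrow> real"
    using integrable_binomial_pmf[OF p, of N h] integrable_distr[OF meas, of h]
    unfolding distr by simp
  show "integrable P (\<lambda>\<omega>. f (K k l \<omega>))" by (rule int)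
  have expect: "expectation (\<lambda>\<omega>. h (K k l \<omega>)) = measure_pmf.expectation (binomial_pmf N p) h"
    for h :: "nat \<Rightarrow> real"
    using integral_distr[OF meas, of h] unfolding distr by simp
  have EK: "expectation (\<lambda>\<omega>. real (K k l \<omega>)) = N * p"
    using expect[of real] by (simp add: expectation_binomial_pmf_real[OF p])
  have "expectation (\<lambda>\<omega>. X_hat N K \<omega> $k$l) = 2 / N * (N * p) - 1"
    using int[of real] by (simp add: X_hat_def EK prob_space)
  also have "\<dots> = X$k$l" using N by (simp add: p_def field_simps)
  finally show E: "expectation (\<lambda>\<omega>. X_hat N K \<omega> $k$l) = X$k$l" .
  have "(X_hat N K \<omega> $k$l - X$k$l)\<^sup>2 = (2 / N)\<^sup>2 * (real (K k l \<omega>) - N * p)\<^sup>2" for \<omega>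
  proof -
    have "X_hat N K \<omega> $k$l - X$k$l = (2 / N) * (real (K k l \<omega>) - N * p)"
      using N by (simp add: X_hat_def p_def field_simps)
    then show ?thesis by (simp only: power_mult_distrib)
  qed
  then have "variance (\<lambda>\<omega>. X_hat N K \<omega> $k$l)
      = (2 / N)\<^sup>2 * expectation (\<lambda>\<omega>. (real (K k l \<omega>) - N * p)\<^sup>2)"
    unfolding E by simp
  also have "\<dots> = (2 / N)\<^sup>2 * (N * p * (1 - p))"
    using expect[of "\<lambda>k. (real k - N * p)\<^sup>2"] by (simp add: variance_binomial_pmf_real[OF p])
  also have "\<dots> = (1 - (X$k$l)\<^sup>2) / N"
    using N by (simp add: p_def field_simps power2_eq_square)
  finally show "variance (\<lambda>\<omega>. X_hat N K \<omega> $k$l) = (1 - (X$k$l)\<^sup>2) / N" .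
qed

text \<open>Each entry of the channel estimator is a linear combination of the nine independent
  entries of \<open>X_hat\<close>, with coefficients \<open>M$i$k * T$j$l\<close>.\<close>

lemma
  assumes md: "measured_data P N (data_matrix A \<tau> \<theta>) K" and N: "N \<ge> 1"
    and X: "\<And>k l. \<bar>data_matrix A \<tau> \<theta> $k$l\<bar> \<le> 1"
  defines "M \<equiv> setting_matrix \<tau>" and "T \<equiv> setting_matrix \<theta>"
  shows expectation_A_hat: "prob_space.expectation P (\<lambda>\<omega>. A_hat \<tau> \<theta> N K \<omega> $i$j) = A$i$j"
    and variance_A_hat: "prob_space.variance P (\<lambda>\<omega>. A_hat \<tau> \<theta> N K \<omega> $i$j)
      = (\<Sum>k\<in>UNIV. \<Sum>l\<in>UNIV. (M$i$k)\<^sup>2 * (T$j$l)\<^sup>2 * (1 - (data_matrix A \<tau> \<theta> $k$l)\<^sup>2)) / real N"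
    and integrable_A_hat_deviation: "integrable P (\<lambda>\<omega>. (A_hat \<tau> \<theta> N K \<omega> $i$j - A$i$j)\<^sup>2)"
proof -
  interpret prob_space P using md by (simp add: measured_data_def)
  define Y where "Y = (\<lambda>(k, l) \<omega>. X_hat N K \<omega> $k$l)"
  define c where "c = (\<lambda>(k, l). M$i$k * T$j$l)"
  \<comment> \<open>The double sum becomes a sum over index pairs, because independence is given for
    the family indexed by pairs.\<close>
  have expand: "(M ** B ** transpose T)$i$j = (\<Sum>(k, l)\<in>UNIV. c (k, l) * B$k$l)" for B
    unfolding UNIV_Times_UNIV[symmetric] sum.cartesian_product[symmetric]
    by (subst sum.swap)
      (simp add: matrix_matrix_mult_def transpose_def c_def sum_distrib_left mult_ac)
  have A_hat: "A_hat \<tau> \<theta> N K \<omega> $i$j = (\<Sum>p\<in>UNIV. c p * Y p \<omega>)" for \<omega>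
    unfolding A_hat_def M_def[symmetric] T_def[symmetric] expand
    by (simp add: Y_def case_prod_unfold)
  have ind: "indep_vars (\<lambda>_. borel) Y UNIV"
  proof -
    have "indep_vars (\<lambda>_. count_space UNIV) (\<lambda>(i, j). K i j) UNIV"
      using md by (simp add: measured_data_def)
    from indep_vars_compose2[OF this, of "\<lambda>_ n. 2 / real N * real n - 1" "\<lambda>_. borel"]
    show ?thesis by (simp add: Y_def X_hat_def case_prod_unfold)
  qed
  have int: "integrable P (Y p)" for p
    using integrable_measured_data[OF md N X, of "\<lambda>n. 2 / real N * real n - 1"]
    by (simp add: Y_def X_hat_def case_prod_unfold)
  have EY: "expectation (Y p) = data_matrix A \<tau> \<theta> $ fst p $ snd p"
    and VY: "variance (Y p) = (1 - (data_matrix A \<tau> \<theta> $ fst p $ snd p)\<^sup>2) / N" for p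
    using expectation_X_hat[OF md N X] variance_X_hat[OF md N X]
    by (simp_all add: Y_def case_prod_unfold)
  have int2: "integrable P (\<lambda>\<omega>. (Y p \<omega> - expectation (Y p))\<^sup>2)" for p
    using integrable_measured_data[OF md N X,
      of "\<lambda>n. (2 / real N * real n - 1 - expectation (Y p))\<^sup>2" "fst p" "snd p"]
    by (simp add: Y_def X_hat_def case_prod_unfold)
  have "expectation (\<lambda>\<omega>. A_hat \<tau> \<theta> N K \<omega> $i$j) = (M ** data_matrix A \<tau> \<theta> ** transpose T)$i$j"
    unfolding A_hat expand using int by (simp add: EY case_prod_unfold)
  then show E: "expectation (\<lambda>\<omega>. A_hat \<tau> \<theta> N K \<omega> $i$j) = A$i$j"
    by (simp add: M_def T_def setting_matrix_data_matrix)
  note sum_indep = variance_sum_indep[OF finite ind int int2, of c]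
  from sum_indep(2) show "integrable P (\<lambda>\<omega>. (A_hat \<tau> \<theta> N K \<omega> $i$j - A$i$j)\<^sup>2)"
    unfolding A_hat[symmetric] E .
  have "variance (\<lambda>\<omega>. A_hat \<tau> \<theta> N K \<omega> $i$j)
      = (\<Sum>(k, l)\<in>UNIV \<times> UNIV.
          (M$i$k)\<^sup>2 * (T$j$l)\<^sup>2 * (1 - (data_matrix A \<tau> \<theta> $k$l)\<^sup>2) / N)"
    unfolding A_hat sum_indep(1) UNIV_Times_UNIV
    by (simp add: VY c_def case_prod_unfold power_mult_distrib)
  then show "variance (\<lambda>\<omega>. A_hat \<tau> \<theta> N K \<omega> $i$j)
      = (\<Sum>k\<in>UNIV. \<Sum>l\<in>UNIV. (M$i$k)\<^sup>2 * (T$j$l)\<^sup>2 * (1 - (data_matrix A \<tau> \<theta> $k$l)\<^sup>2)) / N"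
    by (simp only: sum_divide_distrib sum.cartesian_product case_prod_unfold)
qed

section \<open>The variance bound for the Pauli channel\<close>

theorem theorem10:
  fixes L :: "real^3" and N :: nat
    and \<tau> \<theta> :: "real \<times> real \<times> real"
    and P :: "'w measure" and K :: "3 \<Rightarrow> 3 \<Rightarrow> 'w \<Rightarrow> nat"
  assumes "L $ 1 \<ge> L $ 2" and "L $ 2 \<ge> L $ 3"
    and "1 + L $ 3 \<ge> \<bar>L $ 1 + L $ 2\<bar>"
    and "1 - L $ 3 \<ge> \<bar>L $ 1 - L $ 2\<bar>"
    and "N \<ge> 1"
    and "admissible \<tau>" and "admissible \<theta>"
    and "measured_data P N (data_matrix (pauli_matrix L) \<tau> \<theta>) K"
  shows "g_tilde P K L \<tau> \<theta> N
           = (\<Sum>i\<in>UNIV. prob_space.variance P (\<lambda>\<omega>. A_hat \<tau> \<theta> N K \<omega> $ i $ i))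
       \<and> g_tilde P K L \<tau> \<theta> N
           \<ge> 1 / real N * (3 - ((L $ 1)\<^sup>2 + (L $ 2)\<^sup>2 + (L $ 3)\<^sup>2))
       \<and> (\<tau> = (0, 0, 0) \<and> \<theta> = (0, 0, 0) \<longrightarrow>
          g_tilde P K L \<tau> \<theta> N
            = 1 / real N * (3 - ((L $ 1)\<^sup>2 + (L $ 2)\<^sup>2 + (L $ 3)\<^sup>2)))"
proof -
  interpret prob_space P using assms(8) by (simp add: measured_data_def)
  define M T X where "M = setting_matrix \<tau>" and "T = setting_matrix \<theta>"
    and "X = data_matrix (pauli_matrix L) \<tau> \<theta>"
  note orth = orthogonal_setting_matrix[of \<tau>, folded M_def]
    orthogonal_setting_matrix[of \<theta>, folded T_def]
  \<comment> \<open>For the first two entries, add the two inequalities: the sum of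
    \<open>\<bar>L$1 + L$2\<bar>\<close> and \<open>\<bar>L$1 - L$2\<bar>\<close> is twice the
    larger absolute value.\<close>
  have L: "\<bar>L$i\<bar> \<le> 1" for i
    using exhaust_3[of i] assms(3,4) by (auto simp: abs_le_iff)
  have X: "\<bar>data_matrix (pauli_matrix L) \<tau> \<theta> $k$l\<bar> \<le> 1" for k l
    by (rule abs_data_matrix_pauli_le_1[OF L])
  note est = assms(8,5) X
  have diag: "pauli_matrix L $i$i = L$i" for i by (simp add: pauli_matrix_def)
  let ?V = "\<Sum>i\<in>UNIV. variance (\<lambda>\<omega>. A_hat \<tau> \<theta> N K \<omega> $i$i)"
  let ?c = "1 / real N * (3 - ((L$1)\<^sup>2 + (L$2)\<^sup>2 + (L$3)\<^sup>2))"
  \<comment> \<open>By unbiasedness each \<open>L $ i\<close> is the mean of the diagonal entry it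
    is compared with, so the mean squared errors are variances.\<close>
  have g: "g_tilde P K L \<tau> \<theta> N = ?V"
    unfolding g_tilde_def lambda_tilde_eq[OF assms(1,2)] expectation_A_hat[OF est] diag
    using integrable_A_hat_deviation[OF est, of i i for i] by (simp add: diag)
  have V: "?V = (\<Sum>i\<in>UNIV. \<Sum>k\<in>UNIV. \<Sum>l\<in>UNIV. (M$i$k)\<^sup>2 * (T$i$l)\<^sup>2 * (1 - (X$k$l)\<^sup>2)) / N"
    unfolding variance_A_hat[OF est] M_def T_def X_def by (simp add: sum_divide_distrib)
  define w where "w k l = (\<Sum>i\<in>UNIV. (M$i$k)\<^sup>2 * (T$i$l)\<^sup>2)" for k l
  have T_le: "(T$i$l)\<^sup>2 \<le> 1" for i l
    using member_le_sum[of l UNIV "\<lambda>l. (T$i$l)\<^sup>2"]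
    by (simp add: orthogonal_matrix_row_sum_squares[OF orth(2)])
  \<comment> \<open>Bounding the factor from \<open>T\<close> by 1 leaves the squares of a unit
    column of \<open>M\<close>.\<close>
  have w_le: "w k l \<le> 1" for k l
  proof -
    have "w k l \<le> (\<Sum>i\<in>UNIV. (M$i$k)\<^sup>2 * 1)"
      unfolding w_def by (intro sum_mono mult_left_mono T_le) auto
    then show ?thesis by (simp add: orthogonal_matrix_column_sum_squares[OF orth(1)])
  qed
  have "(\<Sum>k\<in>UNIV. \<Sum>l\<in>UNIV. w k l * (X$k$l)\<^sup>2) \<le> (\<Sum>k\<in>UNIV. \<Sum>l\<in>UNIV. 1 * (X$k$l)\<^sup>2)"
    by (intro sum_mono mult_right_mono w_le) auto
  also have "\<dots> = (L$1)\<^sup>2 + (L$2)\<^sup>2 + (L$3)\<^sup>2"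
    by (simp add: X_def sum_squares_data_matrix) (simp add: pauli_matrix_def sum_3)
  finally have wX: "(\<Sum>k\<in>UNIV. \<Sum>l\<in>UNIV. w k l * (X$k$l)\<^sup>2) \<le> (L$1)\<^sup>2 + (L$2)\<^sup>2 + (L$3)\<^sup>2" .
  have "(\<Sum>i\<in>UNIV. \<Sum>k\<in>UNIV. \<Sum>l\<in>UNIV. (M$i$k)\<^sup>2 * (T$i$l)\<^sup>2 * (1 - (X$k$l)\<^sup>2))
      = (\<Sum>i\<in>UNIV. (\<Sum>k\<in>UNIV. (M$i$k)\<^sup>2) * (\<Sum>l\<in>UNIV. (T$i$l)\<^sup>2))
        - (\<Sum>k\<in>UNIV. \<Sum>l\<in>UNIV. w k l * (X$k$l)\<^sup>2)"
    by (simp add: w_def sum_3 algebra_simps)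
  also have "\<dots> \<ge> 3 - ((L$1)\<^sup>2 + (L$2)\<^sup>2 + (L$3)\<^sup>2)"
    using wX by (simp add: orthogonal_matrix_row_sum_squares orth)
  finally have lower: "?V \<ge> ?c"
    unfolding V by (simp add: divide_right_mono)
  \<comment> \<open>With both settings the identity, the weight \<open>w k l\<close> is 1 on the
    diagonal and 0 elsewhere, and \<open>X\<close> is itself diagonal, so nothing is lost in the
    estimate.\<close>
  moreover have "?V = ?c" if "\<tau> = (0, 0, 0)" "\<theta> = (0, 0, 0)"
  proof -
    have "M = mat 1" "T = mat 1" "X = pauli_matrix L"
      by (simp_all only: M_def T_def X_def data_matrix_def that setting_matrix_zero
        transpose_mat matrix_mul_lid matrix_mul_rid)
    then show ?thesis
      unfolding V by (simp add: sum_3 mat_def diag)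
  qed
  ultimately show ?thesis unfolding g by blast
qed

end
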